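(* Let $G$ be a connected graph with $n$ vertices, $m$ edges and diameter $d$, and let $0<\alpha<1$. Then \[ \alpha^{d}\, n(n-1)+2m\alpha(1-\alpha^{d-1})\;\le\; GC(G)\;\le\;\alpha^{2} n(n-1)+2m\alpha(1-\alpha), \] \[ \frac{n(n-1)}{2^{d}}+m(1-0.5^{d-1})\;\le\; C(G)\;\le\;\frac{n(n-1)+2m}{4}, \] and in each formula equality holds (in both inequalities) if the diameter $d$ is at most $2$.
   Context: All graphs are finite and simple. For vertices $i,j$ of a connected graph $G$, $d(i,j)$ denotes the distance between $i$ and $j$; the diameter of $G$ is $\max_{i,j} d(i,j)$. The closeness of $G$ is $C(G)=\sum_{i\in V(G)}\sum_{j\neq i} 2^{-d(i,j)}$. For a fixed real number $0<\alpha<1$, the generalized closeness is $GC(G)=\sum_{i\in V(G)}\sum_{j\neq i}\alpha^{d(i,j)}$. *)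

theory Defs
  imports Complex_Main "Graph_Theory.Graph_Theory"
begin

text \<open>
  A finite simple graph is a symmetric loop-free digraph without parallel arcs
  (\<^locale>\<open>graph\<close>), so each undirected edge is a pair of opposite arcs. Edges are
  therefore counted as unordered pairs of end points, not as arcs.
\<close>

definition edges :: "('a, 'b) pre_digraph \<Rightarrow> 'a set set" where
  "edges G = (\<lambda>e. {tail G e, head G e}) ` arcs G"

text \<open>The value is meaningful only if some walk joins the two vertices.\<close>

definition graph_dist :: "('a, 'b) pre_digraph \<Rightarrow> 'a \<Rightarrow> 'a \<Rightarrow> nat" where
  "graph_dist G u v = (LEAST k. \<exists>p. pre_digraph.awalk G u p v \<and> length p = k)"

definition graph_diameter :: "('a, 'b) pre_digraph \<Rightarrow> nat" where
  "graph_diameter G = Max {graph_dist G u v | u v. u \<in> verts G \<and> v \<in> verts G}"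

definition closeness :: "('a, 'b) pre_digraph \<Rightarrow> real" where
  "closeness G = (\<Sum>i\<in>verts G. \<Sum>j\<in>verts G - {i}. 2 powi (- int (graph_dist G i j)))"

definition generalized_closeness :: "real \<Rightarrow> ('a, 'b) pre_digraph \<Rightarrow> real" where
  "generalized_closeness \<alpha> G = (\<Sum>i\<in>verts G. \<Sum>j\<in>verts G - {i}. \<alpha> ^ graph_dist G i j)"

end

theory Submission
  imports Defs
begin

text \<open>
  The sum runs over the \<open>n (n - 1)\<close> ordered pairs of distinct vertices. The \<open>2 m\<close> adjacent
  pairs contribute exactly \<open>\<alpha>\<close> each, and every other pair has distance between \<open>2\<close> and
  \<open>d\<close>, hence contributes between \<open>\<alpha>\<^sup>d\<close> and \<open>\<alpha>\<^sup>2\<close>. If \<open>d \<le> 2\<close>, nonadjacent pairs of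
  distinct vertices exist only for \<open>d = 2\<close>, and then the two bounds agree.
\<close>

text \<open>Every fibre of the map to doubletons consists of the two orientations of one pair:
  symmetry supplies the second, irreflexivity keeps them distinct.\<close>

lemma card_sym_irrefl_eq_twice_card_doubletons:
  assumes "finite R" and "sym R" and "\<And>u. (u, u) \<notin> R"
  shows "card R = 2 * card ((\<lambda>(u, v). {u, v}) ` R)"
proof -
  let ?f = "\<lambda>(u, v). {u, v}"
  have fibre: "card {p \<in> R. ?f p = e} = 2" if "e \<in> ?f ` R" for e
  proof -
    from that obtain u v where uv: "(u, v) \<in> R" "e = {u, v}" by auto
    then have "(v, u) \<in> R" "u \<noteq> v" using assms by (auto dest: symD)
    then have "{p \<in> R. ?f p = e} = {(u, v), (v, u)}"
      using uv by (auto simp: doubleton_eq_iff)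
    with \<open>u \<noteq> v\<close> show ?thesis by simp
  qed
  have "card R = (\<Sum>e\<in>?f ` R. card {p \<in> R. ?f p = e})"
    using sum.image_gen[OF \<open>finite R\<close>, of "\<lambda>_. 1::nat" ?f] by simp
  also have "\<dots> = 2 * card (?f ` R)" by (simp add: fibre)
  finally show ?thesis .
qed

lemma (in graph) card_arcs_ends_eq: "card (arcs_ends G) = 2 * card (edges G)"
proof -
  have "edges G = (\<lambda>(u, v). {u, v}) ` arcs_ends G"
    by (auto simp: edges_def arcs_ends_conv image_image)
  moreover have "finite (arcs_ends G)" by (simp add: arcs_ends_def)
  moreover have "(u, u) \<notin> arcs_ends G" for u
    using adj_not_same by blast
  ultimately show ?thesis
    using card_sym_irrefl_eq_twice_card_doubletons sym_arcs by (metis symmetric_def)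
qed

text \<open>\<open>connected\<close> means strong connectivity of the symmetric closure; as the arcs
  are already symmetric, passing to that closure leaves reachability unchanged.\<close>

lemma (in sym_digraph) reachable_if_connected:
  assumes "connected G" and "u \<in> verts G" and "v \<in> verts G"
  shows "u \<rightarrow>\<^sup>* v"
  using assms by (auto simp: connected_def strongly_connected_def reachable_mk_symmetric_eq[OF sym_arcs])

text \<open>Reachability makes the set under \<open>LEAST\<close> nonempty, so the minimum is
  attained by an actual walk.\<close>

lemma (in wf_digraph) awalk_length_graph_dist:
  assumes "u \<rightarrow>\<^sup>* v"
  obtains p where "awalk u p v" and "length p = graph_dist G u v"
proof -
  from assms have "\<exists>k p. awalk u p v \<and> length p = k" by (auto simp: reachable_awalk)
  then have "\<exists>p. awalk u p v \<and> length p = graph_dist G u v"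
    unfolding graph_dist_def by (rule LeastI_ex)
  with that show ?thesis by blast
qed

lemma (in wf_digraph) graph_dist_adjacent:
  assumes "u \<rightarrow> v" and "u \<noteq> v"
  shows "graph_dist G u v = 1"
proof -
  from assms obtain e where e: "e \<in> arcs G" "u = tail G e" "v = head G e"
    by (auto simp: arcs_ends_conv)
  then have "awalk u [e] v" using arc_implies_awalk by blast
  then have "graph_dist G u v \<le> 1"
    unfolding graph_dist_def by (intro Least_le) (auto intro!: exI[of _ "[e]"])
  moreover obtain p where "awalk u p v" "length p = graph_dist G u v"
    using assms awalk_length_graph_dist reachable_adjI by metis
  \<comment> \<open>A walk of length 0 would force its two ends to coincide.\<close>
  then have "graph_dist G u v \<noteq> 0" using \<open>u \<noteq> v\<close> awalk_empty_ends by (cases p) auto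
  ultimately show ?thesis by simp
qed

text \<open>A shortest walk with fewer than two arcs is either empty, giving \<open>u = v\<close>,
  or a single arc, giving adjacency.\<close>

lemma (in wf_digraph) graph_dist_nonadjacent:
  assumes "u \<rightarrow>\<^sup>* v" and "u \<noteq> v" and "\<not> u \<rightarrow> v"
  shows "2 \<le> graph_dist G u v"
proof (rule ccontr)
  assume less: "\<not> 2 \<le> graph_dist G u v"
  obtain p where p: "awalk u p v" "length p = graph_dist G u v"
    using assms(1) by (rule awalk_length_graph_dist)
  show False
  proof (cases p)
    case Nil
    with p assms show ?thesis by (simp add: awalk_Nil_iff)
  next
    case (Cons e q)
    with p less have "q = []" by (cases q) auto
    with p Cons have "e \<in> arcs G" "u = tail G e" "v = head G e" by (auto simp: awalk_simps)
    with assms(3) show ?thesis by (auto simp: arcs_ends_conv)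
  qed
qed

lemma (in fin_digraph) graph_dist_le_diameter:
  assumes "u \<in> verts G" and "v \<in> verts G"
  shows "graph_dist G u v \<le> graph_diameter G"
proof -
  have "{graph_dist G u v | u v. u \<in> verts G \<and> v \<in> verts G}
      = (\<lambda>(u, v). graph_dist G u v) ` (verts G \<times> verts G)" by auto
  then show ?thesis using assms unfolding graph_diameter_def by (intro Max_ge) auto
qed

text \<open>Every ordered pair of distinct vertices gets the base value \<open>b\<close>, and each
  adjacent pair the surplus \<open>a - b\<close>. Taking \<open>a = \<alpha>\<close> and
  \<open>b\<close> a power of \<open>\<alpha>\<close> evaluates both bounds.\<close>

lemma (in digraph) sum_off_diagonal_adjacency:
  fixes a b :: real
  shows "(\<Sum>i\<in>verts G. \<Sum>j\<in>verts G - {i}. if i \<rightarrow> j then a else b)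
    = b * (real (card (verts G)) * (real (card (verts G)) - 1)) + card (arcs_ends G) * (a - b)"
proof -
  let ?V = "verts G"
  have adj: "arcs_ends G = (SIGMA i:?V. {j \<in> ?V - {i}. i \<rightarrow> j})"
    using adj_in_verts adj_not_same by auto
  have row: "(\<Sum>j\<in>?V - {i}. if i \<rightarrow> j then a else b)
      = b * (real (card ?V) - 1) + card {j \<in> ?V - {i}. i \<rightarrow> j} * (a - b)" if "i \<in> ?V" for i
  proof -
    have "(\<Sum>j\<in>?V - {i}. if i \<rightarrow> j then a else b)
        = (\<Sum>j\<in>?V - {i}. b + (if i \<rightarrow> j then a - b else 0))" by (intro sum.cong) auto
    also have "\<dots> = b * real (card (?V - {i})) + card {j \<in> ?V - {i}. i \<rightarrow> j} * (a - b)"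
      by (simp add: sum.distrib sum.inter_filter[symmetric])
    also have "real (card (?V - {i})) = real (card ?V) - 1"
    proof -
      \<comment> \<open>The vertex \<open>i\<close> makes \<open>?V\<close> nonempty, so the natural
        subtraction in the cardinality of \<open>?V - {i}\<close> does not truncate.\<close>
      have "card ?V > 0" using that by (auto simp: card_gt_0_iff)
      then show ?thesis using that by (simp add: of_nat_diff)
    qed
    finally show ?thesis .
  qed
  have "real (card (arcs_ends G)) = (\<Sum>i\<in>?V. real (card {j \<in> ?V - {i}. i \<rightarrow> j}))"
    by (subst adj) simp
  then show ?thesis
    by (simp only: row sum.distrib sum_distrib_right[symmetric] sum_constant cong: sum.cong) simp
qed

lemma closeness_eq_generalized_closeness: "closeness G = generalized_closeness (1 / 2) G"
  by (simp add: closeness_def generalized_closeness_def power_int_minus power_one_over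
      inverse_eq_divide)

context graph
begin

lemma generalized_closeness_lower_bound:
  assumes "0 < \<alpha>" and "\<alpha> < 1"
  defines "n \<equiv> card (verts G)" and "m \<equiv> card (edges G)" and "d \<equiv> graph_diameter G"
  shows "\<alpha> ^ d * (real n * (real n - 1)) + 2 * real m * (\<alpha> - \<alpha> ^ d) \<le> generalized_closeness \<alpha> G"
proof -
  have "(if i \<rightarrow> j then \<alpha> else \<alpha> ^ d) \<le> \<alpha> ^ graph_dist G i j"
    if "i \<in> verts G" "j \<in> verts G - {i}" for i j
    using that assms graph_dist_le_diameter[of i j] graph_dist_adjacent[of i j]
    by (auto intro: power_decreasing)
  then have "(\<Sum>i\<in>verts G. \<Sum>j\<in>verts G - {i}. if i \<rightarrow> j then \<alpha> else \<alpha> ^ d)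
      \<le> generalized_closeness \<alpha> G"
    unfolding generalized_closeness_def by (intro sum_mono)
  then show ?thesis
    by (simp add: sum_off_diagonal_adjacency card_arcs_ends_eq n_def m_def)
qed

text \<open>Connectedness ensures that distances are realised by walks, so distinct nonadjacent
  vertices are at distance at least 2; powers of \<open>\<alpha>\<close> decrease with the
  exponent.\<close>

lemma generalized_closeness_upper_bound:
  assumes "connected G" and "0 < \<alpha>" and "\<alpha> < 1"
  defines "n \<equiv> card (verts G)" and "m \<equiv> card (edges G)"
  shows "generalized_closeness \<alpha> G \<le> \<alpha>\<^sup>2 * (real n * (real n - 1)) + 2 * real m * (\<alpha> - \<alpha>\<^sup>2)"
proof -
  have "\<alpha> ^ graph_dist G i j \<le> (if i \<rightarrow> j then \<alpha> else \<alpha>\<^sup>2)"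
    if "i \<in> verts G" "j \<in> verts G - {i}" for i j
    using that assms graph_dist_adjacent[of i j] graph_dist_nonadjacent[of i j]
      reachable_if_connected[of i j]
    by (auto intro: power_decreasing)
  then have "generalized_closeness \<alpha> G
      \<le> (\<Sum>i\<in>verts G. \<Sum>j\<in>verts G - {i}. if i \<rightarrow> j then \<alpha> else \<alpha>\<^sup>2)"
    unfolding generalized_closeness_def by (intro sum_mono)
  then show ?thesis
    by (simp add: sum_off_diagonal_adjacency card_arcs_ends_eq n_def m_def)
qed

text \<open>The sums agree term by term, with no appeal to monotonicity of powers; hence
  \<open>\<alpha>\<close> may be any real number.\<close>

lemma generalized_closeness_diameter_le_2:
  fixes \<alpha> :: real
  assumes "connected G" and "graph_diameter G \<le> 2"
  defines "n \<equiv> card (verts G)" and "m \<equiv> card (edges G)" and "d \<equiv> graph_diameter G"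
  shows "generalized_closeness \<alpha> G = \<alpha> ^ d * (real n * (real n - 1)) + 2 * real m * (\<alpha> - \<alpha> ^ d)"
    and "generalized_closeness \<alpha> G = \<alpha>\<^sup>2 * (real n * (real n - 1)) + 2 * real m * (\<alpha> - \<alpha>\<^sup>2)"
proof -
  \<comment> \<open>The second conjunct lets \<open>\<alpha> ^ d\<close> and
    \<open>\<alpha>\<^sup>2\<close> be exchanged in the nonadjacent case, which cannot occur when
    \<open>d < 2\<close>.\<close>
  have dist: "graph_dist G i j = (if i \<rightarrow> j then 1 else 2) \<and> (i \<rightarrow> j \<or> d = 2)"
    if "i \<in> verts G" "j \<in> verts G - {i}" for i j
    using that assms(1,2) graph_dist_le_diameter[of i j] graph_dist_adjacent[of i j]
      graph_dist_nonadjacent[of i j] reachable_if_connected[of i j]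
    unfolding d_def by fastforce
  have "generalized_closeness \<alpha> G
      = (\<Sum>i\<in>verts G. \<Sum>j\<in>verts G - {i}. if i \<rightarrow> j then \<alpha> else \<alpha> ^ d)"
    unfolding generalized_closeness_def using dist by (intro sum.cong) auto
  then show "generalized_closeness \<alpha> G
      = \<alpha> ^ d * (real n * (real n - 1)) + 2 * real m * (\<alpha> - \<alpha> ^ d)"
    by (simp add: sum_off_diagonal_adjacency card_arcs_ends_eq n_def m_def)
  have "generalized_closeness \<alpha> G
      = (\<Sum>i\<in>verts G. \<Sum>j\<in>verts G - {i}. if i \<rightarrow> j then \<alpha> else \<alpha>\<^sup>2)"
    unfolding generalized_closeness_def using dist by (intro sum.cong) auto
  then show "generalized_closeness \<alpha> G
      = \<alpha>\<^sup>2 * (real n * (real n - 1)) + 2 * real m * (\<alpha> - \<alpha>\<^sup>2)"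
    by (simp add: sum_off_diagonal_adjacency card_arcs_ends_eq n_def m_def)
qed

end

theorem theorem3p2:
  fixes G :: "('a, 'b) pre_digraph" and n m d :: nat and \<alpha> :: real
  assumes "graph G" and "Digraph_Component.connected G"
    and "n = card (verts G)" and "m = card (edges G)" and "d = graph_diameter G"
    and "0 < \<alpha>" and "\<alpha> < 1"
  shows
    "\<alpha> ^ d * (real n * (real n - 1)) + 2 * real m * \<alpha> * (1 - \<alpha> powi (int d - 1))
        \<le> generalized_closeness \<alpha> G
     \<and> generalized_closeness \<alpha> G
        \<le> \<alpha>\<^sup>2 * (real n * (real n - 1)) + 2 * real m * \<alpha> * (1 - \<alpha>)
     \<and> real n * (real n - 1) / 2 ^ d + real m * (1 - (1 / 2) powi (int d - 1))
        \<le> closeness G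
     \<and> closeness G \<le> (real n * (real n - 1) + 2 * real m) / 4
     \<and> (d \<le> 2 \<longrightarrow>
          \<alpha> ^ d * (real n * (real n - 1)) + 2 * real m * \<alpha> * (1 - \<alpha> powi (int d - 1))
            = generalized_closeness \<alpha> G
          \<and> generalized_closeness \<alpha> G
            = \<alpha>\<^sup>2 * (real n * (real n - 1)) + 2 * real m * \<alpha> * (1 - \<alpha>)
          \<and> real n * (real n - 1) / 2 ^ d + real m * (1 - (1 / 2) powi (int d - 1))
            = closeness G
          \<and> closeness G = (real n * (real n - 1) + 2 * real m) / 4)"
proof -
  interpret graph G by fact
  note conn = \<open>Digraph_Component.connected G\<close>
  note defs = \<open>n = card (verts G)\<close> \<open>m = card (edges G)\<close> \<open>d = graph_diameter G\<close>
  \<comment> \<open>The exponent is an integer, so \<open>x * x powi (int d - 1) = x ^ d\<close>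
    holds even for \<open>d = 0\<close>, where the power is the inverse of \<open>x\<close>.\<close>
  have lower: "2 * real m * x * (1 - x powi (int d - 1)) = 2 * real m * (x - x ^ d)"
    if "x > 0" for x :: real
    using that by (simp add: power_int_diff algebra_simps)
  have upper: "2 * real m * x * (1 - x) = 2 * real m * (x - x\<^sup>2)" for x :: real
    by (simp add: power2_eq_square algebra_simps)
  \<comment> \<open>At \<open>x = 1 / 2\<close> the factor \<open>2 * real m * x\<close> collapses
    to \<open>real m\<close>.\<close>
  have half_lower: "real n * (real n - 1) / 2 ^ d + real m * (1 - (1 / 2) powi (int d - 1))
      = (1 / 2) ^ d * (real n * (real n - 1)) + 2 * real m * (1 / 2 - (1 / 2) ^ d)"
    using lower[of "1 / 2"] by (simp add: power_one_over)
  have half_upper: "(real n * (real n - 1) + 2 * real m) / 4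
      = (1 / 2)\<^sup>2 * (real n * (real n - 1)) + 2 * real m * (1 / 2 - (1 / 2)\<^sup>2)"
    by (simp add: power2_eq_square field_simps)
  show ?thesis
    \<comment> \<open>After this rewriting the claims on \<open>closeness\<close> are the instances
      of the general bounds at \<open>1 / 2\<close>.\<close>
    unfolding lower[OF \<open>0 < \<alpha>\<close>] upper half_lower half_upper closeness_eq_generalized_closeness
    unfolding defs
    by (intro conjI impI generalized_closeness_lower_bound generalized_closeness_upper_bound
        generalized_closeness_diameter_le_2[symmetric] generalized_closeness_diameter_le_2(2)
        conn \<open>0 < \<alpha>\<close> \<open>\<alpha> < 1\<close>) simp_all
qed

end
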